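(* Let $G=(V,A,c)$ be a directed graph with $n=|V|$, $m=|A|$, real arc costs $c:A\to\mathbb{R}$, let $B>0$, and let $s\in V$. Suppose $G$ has no traversable negative cycles. Then the algorithm e-BF (described in the context) run on $G$, $B$, $s$ terminates in $\mathrm{O}(mn)$ time, and at termination $d(v)=\delta_B(s,v)$ for every $v\in V$, and for every $v$ with $\delta_B(s,v)<\infty$, following the pointers $\pi$ from $v$ back to $s$ yields (in reverse) a minimum energetic path from $s$ to $v$.
   Context: Battery model: a car with battery capacity $B>0$ at vertex $u$ with charge $b\in[0,B]$ can traverse arc $uv$ iff $c(uv)\le b$, arriving at $v$ with charge $\min\{b-c(uv),B\}$. For a path $P$ from $u_0$, $d_B(P)=B-b'$ where $b'$ is the final charge when $P$ is traversed starting from $u_0$ with charge $B$, and $d_B(P)=\infty$ if $P$ cannot be so traversed. The energetic cost is $\delta_B(s,t)=\min\{d_B(P): P \text{ an } s\text{-}t \text{ path}\}$ ($\infty$ if no path has finite cost); an $s$-$t$ path $P$ with $d_B(P)=\delta_B(s,t)<\infty$ is a minimum energetic path. A negative cycle is a cycle of negative total cost; it is traversable if it can be traversed starting at some vertex of it with some charge in $[0,B]$ under the battery rules. Define $x\oplus_B y=[x+y]_0^B$ for $x,y\in\mathbb{R}\cup\{\infty\}$ (with $x+\infty=\infty+x=\infty$), where $[z]_0^B=0$ if $z<0$, $=z$ if $0\le z\le B$, $=\infty$ otherwise. Algorithm e-BF: set $d(u)=\infty$, $\pi(u)=\mathrm{null}$ for all $u$, then $d(s)=0$, and a FIFO queue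 $Q$ containing only $s$. While $Q$ is nonempty: delete the front vertex $u$ of $Q$; for each arc $uv\in A$, if $d(u)\oplus_B c(uv)<d(v)$, set $d(v)\gets d(u)\oplus_B c(uv)$, $\pi(v)\gets u$, and append $v$ to the back of $Q$ if $v$ is not in $Q$. *)

theory Defs
  imports
    "HOL-Library.Extended_Real"
    "HOL-Library.While_Combinator"
    "Graph_Theory.Pair_Digraph"
    "Graph_Theory.Weighted_Graph"
begin

section \<open>The battery model\<close>

text \<open>
  Paths are arc walks, so vertices and arcs may repeat. Arcs are pairs of vertices: there are no
  parallel arcs, but loops are allowed.
\<close>

text \<open>
  The charge left after traversing the arcs \<open>P\<close> in order, starting with charge \<open>b\<close>; \<open>None\<close> if some
  arc costs more than the charge available at its tail.
\<close>
fun final_charge :: "real \<Rightarrow> ('e \<Rightarrow> real) \<Rightarrow> real \<Rightarrow> 'e list \<Rightarrow> real option" where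
  "final_charge B c b [] = Some b"
| "final_charge B c b (e # P) = (if c e \<le> b then final_charge B c (min (b - c e) B) P else None)"

definition energetic_path_cost :: "real \<Rightarrow> ('e \<Rightarrow> real) \<Rightarrow> 'e list \<Rightarrow> ereal" where
  "energetic_path_cost B c P =
     (case final_charge B c B P of Some b' \<Rightarrow> ereal (B - b') | None \<Rightarrow> \<infinity>)"

text \<open>
  The infimum over the empty set is \<open>\<infinity>\<close>. That a finite infimum is attained is the existence of a
  minimum energetic path.
\<close>
definition energetic_cost ::
    "'a pair_pre_digraph \<Rightarrow> ('a \<times> 'a \<Rightarrow> real) \<Rightarrow> real \<Rightarrow> 'a \<Rightarrow> 'a \<Rightarrow> ereal" where
  "energetic_cost G c B s t =
     (INF P \<in> {P. pre_digraph.awalk (with_proj G) s P t}. energetic_path_cost B c P)"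

definition min_energetic_path ::
    "'a pair_pre_digraph \<Rightarrow> ('a \<times> 'a \<Rightarrow> real) \<Rightarrow> real \<Rightarrow> 'a \<Rightarrow> ('a \<times> 'a) list \<Rightarrow> 'a \<Rightarrow> bool" where
  "min_energetic_path G c B s P t \<longleftrightarrow>
     pre_digraph.awalk (with_proj G) s P t \<and>
     energetic_path_cost B c P = energetic_cost G c B s t \<and>
     energetic_cost G c B s t < \<infinity>"

definition negative_cycle :: "'a pair_pre_digraph \<Rightarrow> ('a \<times> 'a \<Rightarrow> real) \<Rightarrow> ('a \<times> 'a) list \<Rightarrow> bool" where
  "negative_cycle G c p \<longleftrightarrow>
     pre_digraph.cycle (with_proj G) p \<and> wf_digraph.awalk_cost c p < 0"

text \<open>A cycle is listed from one of its vertices; rotating the list changes the starting vertex.\<close>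
definition traversable_cycle :: "real \<Rightarrow> ('e \<Rightarrow> real) \<Rightarrow> 'e list \<Rightarrow> bool" where
  "traversable_cycle B c p \<longleftrightarrow>
     (\<exists>k b. 0 \<le> b \<and> b \<le> B \<and> final_charge B c b (rotate k p) \<noteq> None)"


section \<open>The algorithm e-BF\<close>

definition clip :: "real \<Rightarrow> ereal \<Rightarrow> ereal" where
  "clip B z = (if z < 0 then 0 else if z \<le> ereal B then z else \<infinity>)"

definition oplus :: "real \<Rightarrow> ereal \<Rightarrow> ereal \<Rightarrow> ereal" where
  "oplus B x y = clip B (x + y)"

record 'a ebf_state =
  dist_of :: "'a \<Rightarrow> ereal"
  pred_of :: "'a \<Rightarrow> 'a option"
  queue :: "'a list"
  elapsed :: nat

text \<open>
  \<open>elapsed\<close> counts unit-cost operations: assignments, tests (including the evaluation of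
  \<open>oplus\<close> in a test), and insertions and deletions at the ends of the queue. The test whether a
  vertex is in the queue has unit cost, as it does if every vertex carries a membership bit.
\<close>

definition ebf_init :: "'a pair_pre_digraph \<Rightarrow> 'a \<Rightarrow> 'a ebf_state" where
  "ebf_init G s =
     \<lparr> dist_of = (\<lambda>_. \<infinity>)(s := 0), pred_of = (\<lambda>_. None), queue = [s],
       elapsed = 2 * card (pverts G) + 2 \<rparr>"

definition ebf_relax ::
    "('a \<times> 'a \<Rightarrow> real) \<Rightarrow> real \<Rightarrow> 'a \<Rightarrow> 'a \<Rightarrow> 'a ebf_state \<Rightarrow> 'a ebf_state" where
  "ebf_relax c B u v st =
     (let x = oplus B (dist_of st u) (ereal (c (u, v))) in
      if x < dist_of st v then
        (if v \<in> set (queue st)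
         then st \<lparr> dist_of := (dist_of st)(v := x), pred_of := (pred_of st)(v := Some u),
                   elapsed := elapsed st + 4 \<rparr>
         else st \<lparr> dist_of := (dist_of st)(v := x), pred_of := (pred_of st)(v := Some u),
                   queue := queue st @ [v], elapsed := elapsed st + 5 \<rparr>)
      else st \<lparr> elapsed := elapsed st + 1 \<rparr>)"

text \<open>
  The two units charged here are the loop test and the deletion from the queue. The list \<open>adj u\<close>
  fixes the order in which the arcs leaving \<open>u\<close> are scanned.
\<close>
definition ebf_iteration ::
    "('a \<Rightarrow> 'a list) \<Rightarrow> ('a \<times> 'a \<Rightarrow> real) \<Rightarrow> real \<Rightarrow> 'a ebf_state \<Rightarrow> 'a ebf_state" where
  "ebf_iteration adj c B st =
     (let u = hd (queue st) in
      fold (ebf_relax c B u) (adj u)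
        (st \<lparr> queue := tl (queue st), elapsed := elapsed st + 2 \<rparr>))"

text \<open>\<open>None\<close> means non-termination. The last unit is the loop test that fails.\<close>
definition e_BF ::
    "'a pair_pre_digraph \<Rightarrow> ('a \<Rightarrow> 'a list) \<Rightarrow> ('a \<times> 'a \<Rightarrow> real) \<Rightarrow> real \<Rightarrow> 'a \<Rightarrow> 'a ebf_state option"
  where
  "e_BF G adj c B s =
     map_option (\<lambda>st. st \<lparr> elapsed := elapsed st + 1 \<rparr>)
       (while_option (\<lambda>st. queue st \<noteq> []) (ebf_iteration adj c B) (ebf_init G s))"

definition adjacency_lists :: "'a pair_pre_digraph \<Rightarrow> ('a \<Rightarrow> 'a list) \<Rightarrow> bool" where
  "adjacency_lists G adj \<longleftrightarrow>
     (\<forall>u \<in> pverts G. distinct (adj u) \<and> set (adj u) = {v. (u, v) \<in> parcs G})"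

text \<open>
  Follows the pointers from \<open>v\<close> until a null pointer is met and returns the vertex reached, together
  with the arcs passed, in the order leading from that vertex to \<open>v\<close>; \<open>None\<close> if the pointers run
  into a cycle or along an infinite chain.
\<close>
definition follow_pointers :: "('a \<Rightarrow> 'a option) \<Rightarrow> 'a \<Rightarrow> ('a \<times> ('a \<times> 'a) list) option" where
  "follow_pointers \<pi> v =
     while_option (\<lambda>(x, P). \<pi> x \<noteq> None) (\<lambda>(x, P). (the (\<pi> x), (the (\<pi> x), x) # P)) (v, [])"

end

theory Submission
  imports Defs
begin

text \<open>
  Capping the charge at \<open>B\<close> only loses energy, so a car that returns to a vertex with more charge
  than before has traversed a closed walk of negative cost. Without traversable negative cycles,
  removing the cycles of a walk therefore never lowers the final charge, and simple paths suffice.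
  The Bellman-Ford argument then carries over to \<open>oplus\<close>, which is monotone: each finite label is
  the cost of some walk, after \<open>k\<close> phases of the queue a label is at most the cost of every walk
  of at most \<open>k\<close> arcs, and a cycle of pointers would let the car gain charge. Hence there are at
  most \<open>n\<close> phases, each scanning every arc at most once.
\<close>

section \<open>Charges along walks\<close>

text \<open>The charge that a label stands for. An infinite label gives the meaningless value
  \<open>B\<close>, so finiteness is tracked separately.\<close>

definition charge :: "real \<Rightarrow> ereal \<Rightarrow> real" where
  "charge B x = B - real_of_ereal x"

lemma final_charge_append:
  "final_charge B c b (P @ Q) = Option.bind (final_charge B c b P) (\<lambda>b'. final_charge B c b' Q)"
  by (induction P arbitrary: b) auto

lemma final_charge_bounds:
  assumes "final_charge B c b P = Some b'" "0 \<le> b" "b \<le> B"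
  shows "0 \<le> b'" "b' \<le> B"
proof -
  have "0 \<le> b' \<and> b' \<le> B"
    using assms
  proof (induction P arbitrary: b)
    case (Cons e P)
    then show ?case by (fastforce split: if_splits)
  qed simp
  then show "0 \<le> b'" "b' \<le> B" by auto
qed

lemma final_charge_mono:
  assumes "final_charge B c b P = Some b1" "b \<le> b'"
  shows "\<exists>b2. final_charge B c b' P = Some b2 \<and> b1 \<le> b2"
  using assms
proof (induction P arbitrary: b b')
  case (Cons e P)
  from Cons.prems have "c e \<le> b" and fc: "final_charge B c (min (b - c e) B) P = Some b1"
    by (auto split: if_splits)
  moreover have "min (b - c e) B \<le> min (b' - c e) B" using Cons.prems(2) by auto
  ultimately show ?case using Cons.IH[OF fc] Cons.prems(2) by auto
qed simp

lemma final_charge_le_sum: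
  assumes "final_charge B c b P = Some b'"
  shows "b' \<le> b - sum_list (map c P)"
  using assms
proof (induction P arbitrary: b)
  case (Cons e P)
  then show ?case by (fastforce split: if_splits)
qed simp

section \<open>Clipped addition as the battery rule for spent energy\<close>

lemma oplus_nonneg: "0 \<le> B \<Longrightarrow> 0 \<le> oplus B x y"
  by (auto simp: oplus_def clip_def)

lemma oplus_mono: "0 \<le> B \<Longrightarrow> x \<le> y \<Longrightarrow> oplus B x z \<le> oplus B y z"
proof -
  assume B: "0 \<le> B" and "x \<le> y"
  then have "x + z \<le> y + z" by (intro add_mono) auto
  with B show ?thesis
    by (auto simp: oplus_def clip_def not_less dest: order_trans)
qed

text \<open>Translates a relaxation inequality from spent energy to charge: the bounds mirror the
  test and the update in \<open>final_charge\<close>.\<close>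

lemma oplus_le_finiteD:
  assumes "oplus B x (ereal r) \<le> y" "0 \<le> x" "y < \<infinity>" "0 \<le> B"
  shows "x < \<infinity>" "r \<le> charge B x" "charge B y \<le> min (charge B x - r) B"
proof -
  have fin: "oplus B x (ereal r) < \<infinity>" using assms by (auto simp: le_less_trans)
  then obtain x' where x: "x = ereal x'" using assms(2)
    by (cases x) (auto simp: oplus_def clip_def split: if_splits)
  have "0 \<le> y" using assms oplus_nonneg order_trans by blast
  then obtain y' where y: "y = ereal y'" "0 \<le> y'" using assms(3) by (cases y) auto
  show "x < \<infinity>" "r \<le> charge B x" "charge B y \<le> min (charge B x - r) B"
    using fin assms x y by (auto simp: oplus_def clip_def charge_def split: if_splits)
qed

text \<open>In terms of spent energy, rounding negative values up to 0 is the cap on the charge, and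
  the jump to \<infinity> above \<open>B\<close> is an arc that cannot be afforded.\<close>

lemma energetic_path_cost_snoc:
  assumes "0 \<le> B"
  shows "energetic_path_cost B c (P @ [e]) = oplus B (energetic_path_cost B c P) (ereal (c e))"
proof (cases "final_charge B c B P")
  case None
  then show ?thesis
    by (simp add: energetic_path_cost_def final_charge_append oplus_def clip_def)
next
  case (Some b)
  then have "0 \<le> b" "b \<le> B" using final_charge_bounds assms by fastforce+
  with Some show ?thesis
    by (auto simp: energetic_path_cost_def final_charge_append oplus_def clip_def min_def
        split: if_splits)
qed

lemma energetic_path_cost_finiteE:
  assumes "energetic_path_cost B c P < \<infinity>"
  obtains b where "final_charge B c B P = Some b" "energetic_path_cost B c P = ereal (B - b)"
  using assms by (auto simp: energetic_path_cost_def split: option.splits)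

text \<open>Negative cycles are simple by definition, so the piece cut out must be simple. The
  induction stops at an arc \<open>e\<close> followed by a simple walk; the stretch from the tail of
  \<open>e\<close> to the next visit of that vertex is then a cycle.\<close>

lemma (in pair_wf_digraph) walk_simple_cycle_decomp:
  assumes "awalk u P v" "\<not> distinct (awalk_verts u P)"
  shows "\<exists>q r t w. P = q @ r @ t \<and> awalk u q w \<and> awalk w r w \<and> cycle r \<and> awalk w t v"
  using assms
proof (induction P arbitrary: u)
  case Nil
  then show ?case by simp
next
  case (Cons e P)
  from Cons.prems(1) have e: "e \<in> parcs G" "fst e = u" and P: "awalk (snd e) P v"
    by (auto simp: awalk_Cons_iff)
  have ew: "awalk u [e] (snd e)"
    using e arc_implies_awalk[of e] by auto
  show ?case
  proof (cases "distinct (awalk_verts (snd e) P)")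
    case False
    from Cons.IH[OF P False] obtain q r t w where
      "P = q @ r @ t" "awalk (snd e) q w" "awalk w r w" "cycle r" "awalk w t v" by blast
    then show ?thesis
      using ew e by (intro exI[of _ "e # q"] exI[of _ r] exI[of _ t] exI[of _ w])
        (auto simp: awalk_Cons_iff)
  next
    case True
    then have "u \<in> set (awalk_verts (snd e) P)"
      using Cons.prems(2) e by auto
    from awalk_decomp[OF P this] obtain q t where
      qt: "P = q @ t" "awalk (snd e) q u" "awalk u t v" by blast
    have "distinct (awalk_verts (snd e) q)"
      using True P qt by (auto simp: awalk_verts_append)
    then have "cycle (e # q)"
      unfolding cycle_def using e qt by (intro exI[of _ u]) (auto simp: awalk_Cons_iff)
    with e qt ew show ?thesis
      by (intro exI[of _ "[]"] exI[of _ "e # q"] exI[of _ t] exI[of _ u])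
        (auto simp: awalk_Cons_iff awalk_Nil_iff dest: in_arcsD1 arc_fst_in_verts)
  qed
qed

section \<open>Graphs without traversable negative cycles\<close>

locale battery_graph = pair_fin_digraph G for G :: "'a pair_pre_digraph" +
  fixes c :: "'a \<times> 'a \<Rightarrow> real" and B :: real
  assumes B_pos: "0 < B"
    and no_trav_neg: "\<not> (\<exists>p. negative_cycle G c p \<and> traversable_cycle B c p)"
begin

text \<open>The given traversal itself shows that the cycle is traversable, so its cost is
  nonnegative; the cap only lowers the charge further.\<close>

lemma cycle_charge_le:
  assumes "cycle r" "final_charge B c b r = Some b'" "0 \<le> b" "b \<le> B"
  shows "b' \<le> b"
proof -
  have "traversable_cycle B c r"
    unfolding traversable_cycle_def using assms by (intro exI[of _ 0] exI[of _ b]) auto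
  with no_trav_neg assms(1) have "0 \<le> awalk_cost c r"
    unfolding negative_cycle_def by force
  moreover have "awalk_cost c r = sum_list (map c r)" by (rule awalk_cost_def)
  ultimately show ?thesis using final_charge_le_sum[OF assms(2)] by simp
qed

text \<open>Deleting a cycle lets the remainder be entered with no less charge, so it can be
  replayed. The starting charge is arbitrary because it is later the charge of a label.\<close>

lemma walk_to_apath:
  assumes "awalk u P v" "final_charge B c b P = Some b1" "0 \<le> b" "b \<le> B"
  shows "\<exists>Q b2. apath u Q v \<and> final_charge B c b Q = Some b2 \<and> b1 \<le> b2"
  using assms
proof (induction "length P" arbitrary: P b1 rule: less_induct)
  case less
  show ?case
  proof (cases "distinct (awalk_verts u P)")
    case True
    then show ?thesis using less.prems by (auto simp: apath_def)
  next
    case False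
    from walk_simple_cycle_decomp[OF less.prems(1) False] obtain q r t w where
      P: "P = q @ r @ t" and w: "awalk u q w" "awalk w r w" "cycle r" "awalk w t v" by blast
    from less.prems(2) obtain bq br where
      bq: "final_charge B c b q = Some bq" and br: "final_charge B c bq r = Some br"
      and bt: "final_charge B c br t = Some b1"
      by (auto simp: P final_charge_append split: bind_splits)
    have "br \<le> bq"
      using cycle_charge_le[OF w(3) br] final_charge_bounds[OF bq less.prems(3,4)] by simp
    from final_charge_mono[OF bt this] obtain b2 where
      "final_charge B c bq t = Some b2" "b1 \<le> b2" by blast
    then have "final_charge B c b (q @ t) = Some b2" by (simp add: final_charge_append bq)
    moreover have "r \<noteq> []" using w(3) by (auto simp: cycle_def)
    then have "length (q @ t) < length P" by (simp add: P)
    moreover have "awalk u (q @ t) v" using w by auto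
    ultimately obtain Q b3 where
      "apath u Q v" "final_charge B c b Q = Some b3" "b2 \<le> b3"
      using less.hyps less.prems(3,4) by blast
    then show ?thesis using \<open>b1 \<le> b2\<close> by (meson order_trans)
  qed
qed

text \<open>The only simple path from \<open>u\<close> to itself is empty and leaves the charge at
  \<open>b\<close>. This extends the bound on cycles to all closed walks.\<close>

lemma closed_walk_charge_le:
  assumes "awalk u P u" "final_charge B c b P = Some b'" "0 \<le> b" "b \<le> B"
  shows "b' \<le> b"
proof -
  from walk_to_apath[OF assms] obtain Q b2 where
    Q: "apath u Q u" "final_charge B c b Q = Some b2" "b' \<le> b2" by blast
  from Q(1) have "Q = []" using apath_nonempty_ends by blast
  with Q show ?thesis by simp
qed

lemma short_walk_le:
  assumes "awalk s P v" "energetic_path_cost B c P < \<infinity>"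
  shows "\<exists>Q. awalk s Q v \<and> length Q < card (pverts G) \<and>
    energetic_path_cost B c Q \<le> energetic_path_cost B c P"
proof -
  from energetic_path_cost_finiteE[OF assms(2)] obtain b where
    b: "final_charge B c B P = Some b" "energetic_path_cost B c P = ereal (B - b)" .
  from walk_to_apath[OF assms(1) b(1)] B_pos obtain Q b2 where
    Q: "apath s Q v" "final_charge B c B Q = Some b2" "b \<le> b2" by auto
  then have "energetic_path_cost B c Q \<le> energetic_path_cost B c P"
    using b by (simp add: energetic_path_cost_def)
  then show ?thesis using Q length_apath_less[OF Q(1)] by (auto simp: apath_def)
qed

end

section \<open>Labels and pointers\<close>

text \<open>Oriented like the arcs, from predecessor to vertex, so that well-foundedness means that
  following pointers backwards ends.\<close>

definition pointer_rel :: "('a \<Rightarrow> 'a option) \<Rightarrow> 'a rel" where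
  "pointer_rel \<pi> = {(u, v). \<pi> v = Some u}"

locale ebf = battery_graph +
  fixes s and adj
  assumes s_vert: "s \<in> pverts G" and adj: "adjacency_lists G adj"
begin

definition labels_ok :: "'a ebf_state \<Rightarrow> bool" where
  "labels_ok st \<longleftrightarrow>
     dist_of st s = 0 \<and> (\<forall>v. 0 \<le> dist_of st v) \<and>
     (\<forall>v. dist_of st v < \<infinity> \<longrightarrow>
        (\<exists>P. awalk s P v \<and> energetic_path_cost B c P = dist_of st v))"

text \<open>An inequality instead of an equality, because the label of \<open>u\<close> may drop
  after the pointer of \<open>v\<close> was set.\<close>

definition pointers_ok :: "'a ebf_state \<Rightarrow> bool" where
  "pointers_ok st \<longleftrightarrow>
     (\<forall>u v. pred_of st v = Some u \<longrightarrow> (u, v) \<in> parcs G \<and> dist_of st v < \<infinity> \<and>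
        oplus B (dist_of st u) (ereal (c (u, v))) \<le> dist_of st v) \<and>
     pred_of st s = None \<and>
     (\<forall>v. dist_of st v < \<infinity> \<longrightarrow> v \<noteq> s \<longrightarrow> pred_of st v \<noteq> None) \<and>
     acyclic (pointer_rel (pred_of st))"

lemma labels_okD:
  assumes "labels_ok st"
  shows "dist_of st s = 0" "0 \<le> dist_of st v"
    "dist_of st v < \<infinity> \<Longrightarrow> \<exists>P. awalk s P v \<and> energetic_path_cost B c P = dist_of st v"
  using assms by (auto simp: labels_ok_def)

lemma pointers_okD:
  assumes "pointers_ok st" "pred_of st v = Some u"
  shows "(u, v) \<in> parcs G" "dist_of st v < \<infinity>"
    "oplus B (dist_of st u) (ereal (c (u, v))) \<le> dist_of st v"
  using assms by (auto simp: pointers_ok_def)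

lemma dist_charge_bounds:
  assumes "labels_ok st" "dist_of st v < \<infinity>"
  shows "0 \<le> charge B (dist_of st v)" "charge B (dist_of st v) \<le> B"
proof -
  from labels_okD(3)[OF assms] obtain P where
    P: "energetic_path_cost B c P = dist_of st v" by blast
  with assms(2) obtain b where "final_charge B c B P = Some b" "dist_of st v = ereal (B - b)"
    by (metis energetic_path_cost_finiteE)
  then show "0 \<le> charge B (dist_of st v)" "charge B (dist_of st v) \<le> B"
    using final_charge_bounds[of B c B P b] B_pos by (auto simp: charge_def)
qed

text \<open>What holds of the arcs \<open>P\<close> collected while following pointers from
  \<open>v\<close> back to \<open>u\<close>. The last inequality can be strict, again because labels
  drop.\<close>

definition label_walk :: "'a ebf_state \<Rightarrow> 'a \<Rightarrow> ('a \<times> 'a) list \<Rightarrow> 'a \<Rightarrow> bool" where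
  "label_walk st u P v \<longleftrightarrow> awalk u P v \<and> dist_of st u < \<infinity> \<and>
     (\<exists>b. final_charge B c (charge B (dist_of st u)) P = Some b \<and> charge B (dist_of st v) \<le> b)"

text \<open>The pointer inequality brings the car across \<open>(u, x)\<close> with at least the
  charge of the label of \<open>x\<close>; monotonicity carries this along \<open>P\<close>.\<close>

lemma label_walk_Cons:
  assumes "labels_ok st" "pointers_ok st" "pred_of st x = Some u" "label_walk st x P v"
  shows "label_walk st u ((u, x) # P) v"
proof -
  note p = pointers_okD[OF assms(2,3)]
  note o = oplus_le_finiteD[OF p(3) labels_okD(2)[OF assms(1)] p(2) less_imp_le[OF B_pos]]
  from assms(4) obtain b where
    b: "final_charge B c (charge B (dist_of st x)) P = Some b" "charge B (dist_of st v) \<le> b"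
    and P: "awalk x P v" by (auto simp: label_walk_def)
  from final_charge_mono[OF b(1) o(3)] b(2) o(1,2) p(1) P show ?thesis
    by (auto simp: label_walk_def awalk_Cons_iff in_arcsD1)
qed

lemma label_walk_Nil: "v \<in> pverts G \<Longrightarrow> dist_of st v < \<infinity> \<Longrightarrow> label_walk st v [] v"
  by (simp add: label_walk_def awalk_Nil_iff)

lemma pointer_chain_label_walk:
  assumes "labels_ok st" "pointers_ok st" "(u, v) \<in> (pointer_rel (pred_of st))\<^sup>*"
    "v \<in> pverts G" "dist_of st v < \<infinity>"
  shows "\<exists>P. label_walk st u P v"
  using assms(3)
proof (induction rule: converse_rtrancl_induct)
  case base
  then show ?case using label_walk_Nil assms by blast
next
  case (step y z)
  then show ?case using label_walk_Cons[OF assms(1,2), of z y] by (auto simp: pointer_rel_def)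
qed

text \<open>
  Closing a pointer cycle by the arc \<open>(u, v)\<close> would let the car return to \<open>v\<close> with more charge than
  it started with.
\<close>
lemma no_pointer_chain_back:
  assumes "labels_ok st" "pointers_ok st" "(u, v) \<in> parcs G"
    and lt: "oplus B (dist_of st u) (ereal (c (u, v))) < dist_of st v"
  shows "(v, u) \<notin> (pointer_rel (pred_of st))\<^sup>*"
proof
  assume chain: "(v, u) \<in> (pointer_rel (pred_of st))\<^sup>*"
  define x where "x = oplus B (dist_of st u) (ereal (c (u, v)))"
  have B0: "0 \<le> B" using B_pos by simp
  have x: "0 \<le> x" "x < \<infinity>" using lt oplus_nonneg[OF B0] by (auto simp: x_def)
  note o = oplus_le_finiteD[OF eq_refl[OF x_def[symmetric]] labels_okD(2)[OF assms(1)] x(2) B0]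
  from pointer_chain_label_walk[OF assms(1,2) chain in_arcsD1[OF assms(3)] o(1)]
  obtain P b where P: "awalk v P u" "dist_of st v < \<infinity>"
    and b: "final_charge B c (charge B (dist_of st v)) P = Some b" "charge B (dist_of st u) \<le> b"
    by (auto simp: label_walk_def)
  have "awalk v (P @ [(u, v)]) v"
    using P assms(3) arc_implies_awalk[OF assms(3)] by (auto intro: awalk_appendI)
  moreover have "final_charge B c (charge B (dist_of st v)) (P @ [(u, v)])
      = Some (min (b - c (u, v)) B)"
    using b o(2) by (simp add: final_charge_append)
  ultimately have "min (b - c (u, v)) B \<le> charge B (dist_of st v)"
    using closed_walk_charge_le dist_charge_bounds[OF assms(1) P(2)] by blast
  \<comment> \<open>Charges fall as labels rise, so this means \<open>dist_of st v \<le> x\<close>,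
    against the strict improvement \<open>lt\<close>.\<close>
  then have "charge B x \<le> charge B (dist_of st v)" using o(3) b(2) by auto
  then have "dist_of st v \<le> x"
    using x P(2) labels_okD(2)[OF assms(1), of v]
    by (cases x; cases "dist_of st v") (auto simp: charge_def)
  with lt show False by (simp add: x_def)
qed

text \<open>The new label is attained by extending a walk that attains the label of
  \<open>u\<close>. Other pointer inequalities survive because a drop at the tail only lowers their
  left side. Fixing just two fields of \<open>st'\<close> covers both relaxing branches.\<close>

lemma relax_labels_pointers:
  assumes "labels_ok st" "pointers_ok st" "(u, v) \<in> parcs G"
    and lt: "oplus B (dist_of st u) (ereal (c (u, v))) < dist_of st v"
    and d': "dist_of st' = (dist_of st)(v := oplus B (dist_of st u) (ereal (c (u, v))))"
    and p': "pred_of st' = (pred_of st)(v := Some u)"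
  shows "labels_ok st'" "pointers_ok st'"
proof -
  define x where "x = oplus B (dist_of st u) (ereal (c (u, v)))"
  have B0: "0 \<le> B" using B_pos by simp
  have x: "0 \<le> x" "x < \<infinity>" "x < dist_of st v" using lt oplus_nonneg[OF B0] by (auto simp: x_def)
  note d' = d'[folded x_def]
  note o = oplus_le_finiteD[OF eq_refl[OF x_def[symmetric]] labels_okD(2)[OF assms(1)] x(2) B0]
  \<comment> \<open>Clipped values are nonnegative, so the label 0 of \<open>s\<close> is never
    improved and \<open>s\<close> keeps its null pointer.\<close>
  have vs: "v \<noteq> s" using x labels_okD(1)[OF assms(1)] by auto
  have le: "dist_of st' y \<le> dist_of st y" for y using x by (simp add: d' less_imp_le)
  from labels_okD(3)[OF assms(1) o(1)] obtain P where
    P: "awalk s P u" "energetic_path_cost B c P = dist_of st u" by blast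
  have "awalk s (P @ [(u, v)]) v"
    using P assms(3) arc_implies_awalk[OF assms(3)] by (auto intro: awalk_appendI)
  moreover have "energetic_path_cost B c (P @ [(u, v)]) = x"
    by (simp add: energetic_path_cost_snoc[OF B0] P x_def)
  ultimately have new: "\<exists>Q. awalk s Q v \<and> energetic_path_cost B c Q = x" by blast
  show "labels_ok st'"
    unfolding labels_ok_def
  proof (intro conjI allI impI)
    fix w
    assume "dist_of st' w < \<infinity>"
    with new labels_okD(3)[OF assms(1), of w]
    show "\<exists>Q. awalk s Q w \<and> energetic_path_cost B c Q = dist_of st' w"
      by (cases "w = v") (simp_all add: d')
  qed (use x vs labels_okD(1,2)[OF assms(1)] in \<open>auto simp: d'\<close>)
  have "oplus B (dist_of st' y) (ereal (c (y, z))) \<le> dist_of st' z \<and>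
      (y, z) \<in> parcs G \<and> dist_of st' z < \<infinity>" if "pred_of st' z = Some y" for y z
  proof (cases "z = v")
    case True
    with that have "y = u" by (simp add: p')
    then show ?thesis
      using True x assms(3) oplus_mono[OF B0 le, of u "ereal (c (u, v))"] by (simp add: d' x_def)
  next
    case False
    with that have z: "pred_of st z = Some y" by (simp add: p')
    note p = pointers_okD[OF assms(2) z]
    from False p order_trans[OF oplus_mono[OF B0 le] p(3)] show ?thesis by (simp add: d')
  qed
  \<comment> \<open>Overwriting a pointer adds one pair and at most removes others, so acyclicity of
    the old relation with \<open>(u, v)\<close> added suffices.\<close>
  moreover have "acyclic (pointer_rel (pred_of st'))"
  proof (rule acyclic_subset)
    show "acyclic (insert (u, v) (pointer_rel (pred_of st)))"
      using no_pointer_chain_back[OF assms(1-4)] assms(2)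
      by (simp add: pointers_ok_def acyclic_insert)
    show "pointer_rel (pred_of st') \<subseteq> insert (u, v) (pointer_rel (pred_of st))"
      by (auto simp: pointer_rel_def p' split: if_splits)
  qed
  ultimately show "pointers_ok st'"
    using assms(2) vs by (auto simp: pointers_ok_def p' d')
qed

section \<open>Following pointers, and labels that no arc improves\<close>

lemma follow_pointers_label_walk:
  assumes "labels_ok st" "pointers_ok st" "v \<in> pverts G" "dist_of st v < \<infinity>"
  shows "\<exists>P. follow_pointers (pred_of st) v = Some (s, P) \<and> label_walk st s P v"
proof -
  let ?\<pi> = "pred_of st"
  let ?b = "\<lambda>(x, P :: ('a \<times> 'a) list). ?\<pi> x \<noteq> None"
  let ?f = "\<lambda>(x, P). (the (?\<pi> x), (the (?\<pi> x), x) # P)"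
  let ?I = "\<lambda>(x, P). label_walk st x P v"
  have step: "?I (?f y)" if "?I y" "?b y" for y
    using that label_walk_Cons[OF assms(1,2)] by (cases y) auto
  \<comment> \<open>Pointers run along arcs, so their relation is finite; being acyclic, it is
    well-founded and the loop ends.\<close>
  have "pointer_rel ?\<pi> \<subseteq> parcs G"
    using pointers_okD(1)[OF assms(2)] by (auto simp: pointer_rel_def)
  then have "finite (pointer_rel ?\<pi>)" using finite_subset pair_finite_arcs by blast
  then have "wf (pointer_rel ?\<pi>)"
    using assms(2) by (auto simp: pointers_ok_def intro: finite_acyclic_wf)
  then have "wf (inv_image (pointer_rel ?\<pi>) (fst :: 'a \<times> ('a \<times> 'a) list \<Rightarrow> 'a))" by simp
  then have "wf {(t, y). (?I y \<and> ?b y) \<and> t = ?f y}"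
    by (rule wf_subset) (auto simp: pointer_rel_def)
  moreover have init: "?I (v, [])" using label_walk_Nil assms by simp
  ultimately have "\<exists>t. while_option ?b ?f (v, []) = Some t"
    using step by (intro wf_while_option_Some[where P = ?I])
  then obtain x P where t: "while_option ?b ?f (v, []) = Some (x, P)" by auto
  have "?I (x, P)" using while_option_rule[where P = ?I, OF step t init] by blast
  then have I: "label_walk st x P v" by simp
  from while_option_stop[OF t] have "?\<pi> x = None" by simp
  with I assms(2) have "x = s" by (auto simp: pointers_ok_def label_walk_def)
  with t I show ?thesis by (auto simp: follow_pointers_def)
qed

text \<open>Relaxed arcs bound each label by the cost of every walk, by induction on the last arc;
  attained labels give the other inequality.\<close>

lemma final_state_correct:
  assumes "labels_ok st" "pointers_ok st"
    and relaxed: "\<And>u v. (u, v) \<in> parcs G \<Longrightarrow>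
      dist_of st v \<le> oplus B (dist_of st u) (ereal (c (u, v)))"
    and v: "v \<in> pverts G"
  shows "dist_of st v = energetic_cost G c B s v"
    and "energetic_cost G c B s v < \<infinity> \<Longrightarrow>
      \<exists>P. follow_pointers (pred_of st) v = Some (s, P) \<and> min_energetic_path G c B s P v"
proof -
  have B0: "0 \<le> B" using B_pos by simp
  have le: "dist_of st w \<le> energetic_path_cost B c P" if "awalk s P w" for P w
    using that
  proof (induction P arbitrary: w rule: rev_induct)
    case Nil
    then show ?case using labels_okD(1)[OF assms(1)]
      by (simp add: awalk_Nil_iff energetic_path_cost_def)
  next
    case (snoc e P)
    then have e: "e \<in> parcs G" "awalk s P (fst e)" "snd e = w"
      by (auto simp: awalk_simps)
    then have "dist_of st w \<le> oplus B (dist_of st (fst e)) (ereal (c e))"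
      using relaxed[of "fst e" "snd e"] by (metis prod.collapse)
    also have "\<dots> \<le> oplus B (energetic_path_cost B c P) (ereal (c e))"
      by (intro oplus_mono B0 snoc.IH e)
    finally show ?case by (simp add: energetic_path_cost_snoc[OF B0])
  qed
  have "energetic_cost G c B s v \<le> dist_of st v"
  proof (cases "dist_of st v < \<infinity>")
    case True
    from labels_okD(3)[OF assms(1) this] show ?thesis
      unfolding energetic_cost_def by (metis INF_lower mem_Collect_eq)
  qed simp
  moreover have "dist_of st v \<le> energetic_cost G c B s v"
    unfolding energetic_cost_def by (intro INF_greatest) (auto intro: le)
  ultimately show eq: "dist_of st v = energetic_cost G c B s v" by simp
  assume fin: "energetic_cost G c B s v < \<infinity>"
  with follow_pointers_label_walk[OF assms(1,2) v] obtain P where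
    P: "follow_pointers (pred_of st) v = Some (s, P)" "label_walk st s P v" by (auto simp: eq)
  \<comment> \<open>The label 0 of \<open>s\<close> is the full charge \<open>B\<close>, from which
    \<open>energetic_path_cost\<close> starts.\<close>
  from P(2) labels_okD(1)[OF assms(1)] obtain b where b: "awalk s P v"
    "final_charge B c B P = Some b" "charge B (dist_of st v) \<le> b"
    by (auto simp: label_walk_def charge_def)
  have "energetic_path_cost B c P \<le> dist_of st v"
    using b fin labels_okD(2)[OF assms(1), of v]
    by (cases "dist_of st v") (auto simp: charge_def energetic_path_cost_def eq)
  with le[OF b(1)] have "energetic_path_cost B c P = energetic_cost G c B s v" by (simp add: eq)
  with P(1) b(1) fin show "\<exists>P. follow_pointers (pred_of st) v = Some (s, P) \<and>
      min_energetic_path G c B s P v" by (auto simp: min_energetic_path_def)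
qed

section \<open>Phases\<close>

text \<open>
  In phase \<open>k\<close> the vertices \<open>xs\<close> queued at its start are still to be scanned and \<open>ys\<close> have been
  queued during it. \<open>E\<close> contains the arcs that the scan in progress has not reached yet.
\<close>
definition phase where
  "phase k E xs ys st \<longleftrightarrow>
     labels_ok st \<and> pointers_ok st \<and>
     queue st = xs @ ys \<and> distinct (xs @ ys) \<and> set (xs @ ys) \<subseteq> insert s (snd ` parcs G) \<and>
     (\<forall>P v. awalk s P v \<longrightarrow> length P \<le> k \<longrightarrow> dist_of st v \<le> energetic_path_cost B c P) \<and>
     (\<forall>P u v. awalk s P u \<longrightarrow> length P \<le> k \<longrightarrow> u \<notin> set xs \<longrightarrow> (u, v) \<in> parcs G - E \<longrightarrow>
        dist_of st v \<le> energetic_path_cost B c (P @ [(u, v)])) \<and>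
     (\<forall>u v. (u, v) \<in> parcs G - E \<longrightarrow> u \<notin> set (xs @ ys) \<longrightarrow>
        dist_of st v \<le> oplus B (dist_of st u) (ereal (c (u, v)))) \<and>
     k < card (pverts G) \<and> (Suc k = card (pverts G) \<longrightarrow> ys = [])"

text \<open>Allows pairs in \<open>E\<close> that are no arcs, so that a scan of \<open>u\<close>
  can start with \<open>{u} \<times> UNIV\<close>.\<close>

lemma phase_cong:
  "parcs G - E = parcs G - E' \<Longrightarrow> phase k E xs ys st = phase k E' xs ys st"
  by (simp only: phase_def)

text \<open>
  In the last phase all labels are final, since every walk can be shortened to a simple path, of at
  most \<open>card (pverts G) - 1\<close> arcs, without losing charge.
\<close>
lemma no_relax_in_last_phase:
  assumes ph: "phase k E xs ys st" and k: "Suc k = card (pverts G)" and a: "(u, v) \<in> parcs G"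
  shows "dist_of st v \<le> oplus B (dist_of st u) (ereal (c (u, v)))" (is "_ \<le> ?x")
proof (cases "?x < \<infinity>")
  case True
  have B0: "0 \<le> B" using B_pos by simp
  have lab: "labels_ok st" using ph by (simp add: phase_def)
  have "dist_of st u < \<infinity>"
    using oplus_le_finiteD(1)[OF order_refl labels_okD(2)[OF lab] True B0] .
  from labels_okD(3)[OF lab this] obtain P where
    P: "awalk s P u" "energetic_path_cost B c P = dist_of st u" by blast
  have w: "awalk s (P @ [(u, v)]) v"
    using P a arc_implies_awalk[OF a] by (auto intro: awalk_appendI)
  have x: "energetic_path_cost B c (P @ [(u, v)]) = ?x"
    by (simp add: energetic_path_cost_snoc[OF B0] P)
  from short_walk_le[OF w] True x obtain Q where
    Q: "awalk s Q v" "length Q < card (pverts G)" "energetic_path_cost B c Q \<le> ?x" by auto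
  with k have "length Q \<le> k" by simp
  with ph Q have "dist_of st v \<le> energetic_path_cost B c Q" by (simp add: phase_def)
  with Q(3) show ?thesis by simp
qed auto

text \<open>Afterwards the label of \<open>v\<close> is at most \<open>x\<close>, and
  \<open>x\<close> is at most the cost of any walk of at most \<open>k\<close> arcs to
  \<open>u\<close> extended by \<open>(u, v)\<close>, because the label of \<open>u\<close> already
  respects such walks. So the arc can leave \<open>E\<close>.\<close>

lemma phase_relax:
  assumes ph: "phase k E xs ys st" and a: "(u, v) \<in> parcs G"
  shows "\<exists>ys'. phase k (E - {(u, v)}) xs ys' (ebf_relax c B u v st)"
proof -
  define x where "x = oplus B (dist_of st u) (ereal (c (u, v)))"
  define st' where "st' = ebf_relax c B u v st"
  have B0: "0 \<le> B" using B_pos by simp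
  have lab: "labels_ok st" "pointers_ok st" using ph by (simp_all add: phase_def)
  have A: "dist_of st w \<le> energetic_path_cost B c P" if "awalk s P w" "length P \<le> k" for P w
    using ph that by (simp add: phase_def)
  have x_le: "x \<le> energetic_path_cost B c (P @ [(u, v)])" if "awalk s P u" "length P \<le> k" for P
    using oplus_mono[OF B0 A[OF that]] by (simp add: energetic_path_cost_snoc[OF B0] x_def)
  show ?thesis
  proof (cases "x < dist_of st v")
    case False
    then have d: "dist_of st' = dist_of st" "pred_of st' = pred_of st" "queue st' = queue st"
      by (simp_all add: st'_def ebf_relax_def x_def)
    have le: "dist_of st v \<le> x" using False by simp
    have "phase k (E - {(u, v)}) xs ys st'"
      using ph le order_trans[OF le x_le]
      unfolding phase_def labels_ok_def pointers_ok_def d by (auto simp: x_def)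
    then show ?thesis unfolding st'_def by blast
  next
    case True
    define ys' where "ys' = (if v \<in> set (xs @ ys) then ys else ys @ [v])"
    have q: "queue st = xs @ ys" using ph by (simp add: phase_def)
    have d: "dist_of st' = (dist_of st)(v := x)" "pred_of st' = (pred_of st)(v := Some u)"
      "queue st' = xs @ ys'"
      using True q by (simp_all add: st'_def ebf_relax_def Let_def ys'_def flip: x_def)
    note lab' = relax_labels_pointers[OF lab a True[unfolded x_def] d(1)[unfolded x_def] d(2)]
    have le: "dist_of st' w \<le> dist_of st w" for w using True by (simp add: d less_imp_le)
    have v_in: "v \<in> set (xs @ ys')" by (auto simp: ys'_def)
    have sub: "set (xs @ ys) \<subseteq> set (xs @ ys')" by (auto simp: ys'_def)
    have 1: "distinct (xs @ ys')" "set (xs @ ys') \<subseteq> insert s (snd ` parcs G)"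
    proof -
      have "distinct (xs @ ys)" "set (xs @ ys) \<subseteq> insert s (snd ` parcs G)"
        using ph by (simp_all add: phase_def)
      moreover have "v \<in> snd ` parcs G" using a by force
      ultimately show "distinct (xs @ ys')" "set (xs @ ys') \<subseteq> insert s (snd ` parcs G)"
        by (auto simp: ys'_def)
    qed
    have 2: "dist_of st' w \<le> energetic_path_cost B c P" if "awalk s P w" "length P \<le> k" for P w
      using order_trans[OF le A[OF that]] .
    have 3: "dist_of st' w \<le> energetic_path_cost B c (P @ [(y, w)])"
      if "awalk s P y" "length P \<le> k" "y \<notin> set xs" "(y, w) \<in> parcs G - (E - {(u, v)})" for P y w
    proof (cases "(y, w) = (u, v)")
      case True
      then show ?thesis using x_le that by (simp add: d)
    next
      case False
      then have "dist_of st w \<le> energetic_path_cost B c (P @ [(y, w)])"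
        using ph that by (simp add: phase_def)
      with le show ?thesis by (rule order_trans)
    qed
    have 4: "dist_of st' w \<le> oplus B (dist_of st' y) (ereal (c (y, w)))"
      if "y \<notin> set (xs @ ys')" "(y, w) \<in> parcs G - (E - {(u, v)})" for y w
    proof -
      \<comment> \<open>The vertex whose label dropped is in the queue, so \<open>y\<close> still
        has its old label.\<close>
      have y: "y \<noteq> v" "y \<notin> set (xs @ ys)" using that v_in sub by auto
      show ?thesis
      proof (cases "(y, w) = (u, v)")
        case True
        then show ?thesis using y by (simp add: d x_def)
      next
        case False
        then have "dist_of st w \<le> oplus B (dist_of st y) (ereal (c (y, w)))"
          using ph that y by (simp add: phase_def)
        with le[of w] have "dist_of st' w \<le> oplus B (dist_of st y) (ereal (c (y, w)))"
          by (rule order_trans)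
        then show ?thesis using y by (simp add: d)
      qed
    qed
    \<comment> \<open>A label has dropped, so this is not the last phase and \<open>ys'\<close> may
      be nonempty.\<close>
    have 5: "Suc k \<noteq> card (pverts G)"
      using no_relax_in_last_phase[OF ph _ a] True by (auto simp: x_def)
    have "phase k (E - {(u, v)}) xs ys' st'"
      unfolding phase_def using lab' d(3) 1 2 3 4 5 ph by (simp add: phase_def)
    then show ?thesis unfolding st'_def by blast
  qed
qed

section \<open>One iteration of the queue and the change of phase\<close>

lemma elapsed_relax:
  "elapsed st \<le> elapsed (ebf_relax c B u v st)" "elapsed (ebf_relax c B u v st) \<le> elapsed st + 5"
  by (auto simp: ebf_relax_def Let_def)

lemma elapsed_scan:
  "elapsed st \<le> elapsed (fold (ebf_relax c B u) vs st) \<and>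
   elapsed (fold (ebf_relax c B u) vs st) \<le> elapsed st + 5 * length vs"
proof (induction vs arbitrary: st)
  case (Cons v vs)
  from Cons.IH[of "ebf_relax c B u v st"] elapsed_relax[where st = st and u = u and v = v] show ?case by auto
qed simp

lemma phase_scan:
  assumes "phase k E xs ys st" "\<forall>v \<in> set vs. (u, v) \<in> parcs G"
  shows "\<exists>ys'. phase k (E - {u} \<times> set vs) xs ys' (fold (ebf_relax c B u) vs st)"
  using assms
proof (induction vs arbitrary: st E ys)
  case Nil
  then show ?case by auto
next
  case (Cons v vs)
  from Cons.prems phase_relax obtain ys' where
    "phase k (E - {(u, v)}) xs ys' (ebf_relax c B u v st)" by (metis list.set_intros(1))
  from Cons.IH[OF this] Cons.prems(2) obtain ys'' where
    "phase k (E - {(u, v)} - {u} \<times> set vs) xs ys'' (fold (ebf_relax c B u) (v # vs) st)"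
    by auto
  moreover have "E - {(u, v)} - {u} \<times> set vs = E - {u} \<times> set (v # vs)" by auto
  ultimately show ?case by metis
qed

lemma queue_vertex:
  assumes "phase k E xs ys st" "u \<in> set (xs @ ys)"
  shows "u \<in> pverts G"
  using assms s_vert unfolding phase_def by (blast dest: arc_snd_in_verts)

lemma phase_iteration:
  assumes ph: "phase k {} (u # xs) ys st"
  shows "\<exists>ys'. phase k {} xs ys' (ebf_iteration adj c B st)"
    and "elapsed st < elapsed (ebf_iteration adj c B st)"
    and "elapsed (ebf_iteration adj c B st) \<le> elapsed st + (2 + 5 * length (adj u))"
proof -
  define st1 where "st1 = st\<lparr>queue := tl (queue st), elapsed := elapsed st + 2\<rparr>"
  have q: "queue st = u # xs @ ys" using ph by (simp add: phase_def)
  have it: "ebf_iteration adj c B st = fold (ebf_relax c B u) (adj u) st1"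
    by (simp add: ebf_iteration_def q st1_def)
  have adj_u: "set (adj u) = {v. (u, v) \<in> parcs G}"
    using adj queue_vertex[OF ph, of u] by (simp add: adjacency_lists_def)
  \<comment> \<open>When \<open>u\<close> leaves the queue its arcs are unscanned, so all of them
    are placed in \<open>E\<close>; the scan removes them one by one.\<close>
  have "phase k ({u} \<times> UNIV) xs ys st1"
    using ph q unfolding phase_def labels_ok_def pointers_ok_def by (auto simp: st1_def)
  from phase_scan[OF this, of "adj u" u] adj_u obtain ys' where
    "phase k ({u} \<times> UNIV - {u} \<times> set (adj u)) xs ys' (ebf_iteration adj c B st)"
    by (auto simp: it)
  moreover have "parcs G - ({u} \<times> UNIV - {u} \<times> set (adj u)) = parcs G - {}" using adj_u by auto
  ultimately have "phase k {} xs ys' (ebf_iteration adj c B st)" using phase_cong by blast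
  then show "\<exists>ys'. phase k {} xs ys' (ebf_iteration adj c B st)" ..
  show "elapsed st < elapsed (ebf_iteration adj c B st)"
    "elapsed (ebf_iteration adj c B st) \<le> elapsed st + (2 + 5 * length (adj u))"
    using elapsed_scan[of st1 u "adj u"] by (auto simp: it st1_def)
qed

text \<open>With nothing left to scan, labels respect all walks of at most \<open>k\<close> arcs
  extended by one arc. A vertex not queued again has all its arcs relaxed, so these respect
  extensions of walks of at most \<open>Suc k\<close> arcs.\<close>

lemma phase_switch:
  assumes ph: "phase k {} [] ys st" and ne: "ys \<noteq> []"
  shows "phase (Suc k) {} ys [] st"
proof -
  have B0: "0 \<le> B" using B_pos by simp
  have A: "dist_of st w \<le> energetic_path_cost B c P" if "awalk s P w" "length P \<le> Suc k" for P w
  proof (cases P rule: rev_cases)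
    case Nil
    then show ?thesis using ph that by (simp add: phase_def)
  next
    case (snoc P' e)
    with that have "awalk s P' (fst e)" "(fst e, w) \<in> parcs G" "e = (fst e, w)" "length P' \<le> k"
      by (auto simp: awalk_simps)
    then show ?thesis using ph snoc unfolding phase_def
      by (metis Diff_empty empty_iff empty_set)
  qed
  have 3: "dist_of st w \<le> energetic_path_cost B c (P @ [(y, w)])"
    if "awalk s P y" "length P \<le> Suc k" "y \<notin> set ys" "(y, w) \<in> parcs G" for P y w
  proof -
    have "dist_of st w \<le> oplus B (dist_of st y) (ereal (c (y, w)))"
      using ph that by (simp add: phase_def)
    also have "\<dots> \<le> oplus B (energetic_path_cost B c P) (ereal (c (y, w)))"
      by (intro oplus_mono B0 A that)
    finally show ?thesis by (simp add: energetic_path_cost_snoc[OF B0])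
  qed
  have "Suc k < card (pverts G)" using ph ne unfolding phase_def by (metis Suc_lessI)
  with A 3 ph show ?thesis by (simp add: phase_def)
qed

lemma phase_init: "phase 0 {} [s] [] (ebf_init G s)"
proof -
  have "0 < card (pverts G)" using s_vert pair_finite_verts card_gt_0_iff by blast
  moreover have "awalk s [] s" using s_vert by (simp add: awalk_Nil_iff)
  ultimately show ?thesis
    unfolding phase_def labels_ok_def pointers_ok_def ebf_init_def
    using B_pos
    by (auto simp: pointer_rel_def energetic_path_cost_def awalk_Nil_iff oplus_def clip_def
        acyclic_def intro!: exI[of _ "[]"])
qed


section \<open>Running time\<close>

text \<open>Worst-case scanning time: 2 for the loop test and the deletion, and per arc 5, the
  dearest branch of \<open>ebf_relax\<close>.\<close>

definition work :: "'a list \<Rightarrow> nat" where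
  "work xs = (\<Sum>u\<leftarrow>xs. 2 + 5 * length (adj u))"

text \<open>With \<open>m\<close> arcs, at most \<open>m + 1\<close> vertices are queued, as all but
  \<open>s\<close> are heads of arcs, and out-degrees sum to at most \<open>m\<close>:
  \<open>2 * (m + 1) + 5 * m\<close>. Counting all vertices instead would spoil the product bound
  when arcs are few.\<close>

lemma work_le:
  assumes "distinct xs" "set xs \<subseteq> insert s (snd ` parcs G)"
  shows "work xs \<le> 7 * card (parcs G) + 2"
proof -
  have xs: "set xs \<subseteq> pverts G" using assms(2) s_vert arc_snd_in_verts by blast
  have len: "length (adj u) = card {v. (u, v) \<in> parcs G}" if "u \<in> set xs" for u
    using adj xs that by (metis adjacency_lists_def distinct_card subsetD)
  have "finite {v. (u, v) \<in> parcs G}" for u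
    by (rule finite_subset[of _ "snd ` parcs G"]) (force simp: pair_finite_arcs)+
  then have "(\<Sum>u\<in>set xs. card {v. (u, v) \<in> parcs G})
      = card (SIGMA u : set xs. {v. (u, v) \<in> parcs G})" by simp
  also have "\<dots> \<le> card (parcs G)"
    by (rule card_mono) (auto simp: pair_finite_arcs)
  finally have deg: "(\<Sum>u\<in>set xs. length (adj u)) \<le> card (parcs G)" by (simp add: len)
  have "card (set xs) \<le> card (insert s (snd ` parcs G))"
    using assms(2) by (intro card_mono) (auto simp: pair_finite_arcs)
  also have "\<dots> \<le> Suc (card (snd ` parcs G))"
    by (simp add: card_insert_if pair_finite_arcs)
  also have "\<dots> \<le> Suc (card (parcs G))" by (simp add: card_image_le pair_finite_arcs)
  finally have "card (set xs) \<le> Suc (card (parcs G))" .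
  moreover have "work xs = 2 * card (set xs) + 5 * (\<Sum>u\<in>set xs. length (adj u))"
    unfolding work_def sum_list_distinct_conv_sum_set[OF assms(1)]
    by (simp only: sum.distrib sum_distrib_left sum_constant) simp
  ultimately show ?thesis using deg by simp
qed

text \<open>An amortised bound: each phase has a budget, and scans still due in the current phase
  count as spent. Vertices in \<open>ys\<close> are paid from the next budget.\<close>

definition run_inv :: "'a ebf_state \<Rightarrow> bool" where
  "run_inv st \<longleftrightarrow> (\<exists>k xs ys. phase k {} xs ys st \<and>
     elapsed st + work xs \<le> 2 * card (pverts G) + 2 + Suc k * (7 * card (parcs G) + 2))"

lemma run_inv_init: "run_inv (ebf_init G s)"
proof -
  have "work [s] \<le> 7 * card (parcs G) + 2" by (rule work_le) auto
  then show ?thesis unfolding run_inv_def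
    by (intro exI[of _ 0] exI[of _ "[s]"] exI[of _ "[]"]) (simp add: phase_init, simp add: ebf_init_def)
qed

lemma run_inv_step:
  assumes "run_inv st" "queue st \<noteq> []"
  shows "run_inv (ebf_iteration adj c B st)" "elapsed st < elapsed (ebf_iteration adj c B st)"
proof -
  let ?M = "7 * card (parcs G) + 2" and ?n = "card (pverts G)"
  \<comment> \<open>An exhausted phase is switched first, which frees a further budget; the front
    vertex then belongs to the current phase.\<close>
  have "\<exists>k u xs ys. phase k {} (u # xs) ys st \<and>
      elapsed st + work (u # xs) \<le> 2 * ?n + 2 + Suc k * ?M"
  proof -
    from assms(1) obtain k xs ys where ph: "phase k {} xs ys st"
      and w: "elapsed st + work xs \<le> 2 * ?n + 2 + Suc k * ?M" unfolding run_inv_def by blast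
    show ?thesis
    proof (cases xs)
      case Nil
      with ph assms(2) have ys: "ys \<noteq> []" by (simp add: phase_def)
      from phase_switch[OF _ ys] ph Nil have ph': "phase (Suc k) {} ys [] st" by simp
      then have "work ys \<le> ?M" by (intro work_le) (auto simp: phase_def)
      with w have "elapsed st + work ys \<le> 2 * ?n + 2 + Suc (Suc k) * ?M" by simp
      with ph' ys show ?thesis by (metis neq_Nil_conv)
    qed (use ph w in blast)
  qed
  then obtain k u xs ys where ph: "phase k {} (u # xs) ys st"
    and w: "elapsed st + work (u # xs) \<le> 2 * ?n + 2 + Suc k * ?M" by blast
  note it = phase_iteration[OF ph]
  from it(1) obtain ys' where "phase k {} xs ys' (ebf_iteration adj c B st)" by blast
  moreover have "elapsed (ebf_iteration adj c B st) + work xs \<le> 2 * ?n + 2 + Suc k * ?M"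
    using it(3) w by (simp add: work_def)
  ultimately show "run_inv (ebf_iteration adj c B st)" unfolding run_inv_def by blast
  show "elapsed st < elapsed (ebf_iteration adj c B st)" by (rule it(2))
qed

lemma run_inv_elapsed:
  assumes "run_inv st"
  shows "elapsed st \<le> 2 * card (pverts G) + 2 + card (pverts G) * (7 * card (parcs G) + 2)"
proof -
  from assms obtain k xs ys where "phase k {} xs ys st"
    and w: "elapsed st + work xs \<le> 2 * card (pverts G) + 2 + Suc k * (7 * card (parcs G) + 2)"
    unfolding run_inv_def by blast
  then have "Suc k \<le> card (pverts G)" by (simp add: phase_def)
  then have "Suc k * (7 * card (parcs G) + 2) \<le> card (pverts G) * (7 * card (parcs G) + 2)"
    by (rule mult_le_mono1)
  with w show ?thesis by linarith
qed

section \<open>Termination and the final bounds\<close>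

lemma e_BF_correct:
  "\<exists>st. e_BF G adj c B s = Some st \<and>
     elapsed st \<le> 14 * (max 1 (card (parcs G)) * card (pverts G)) \<and>
     (\<forall>v \<in> pverts G. dist_of st v = energetic_cost G c B s v) \<and>
     (\<forall>v \<in> pverts G. energetic_cost G c B s v < \<infinity> \<longrightarrow>
        (\<exists>P. follow_pointers (pred_of st) v = Some (s, P) \<and> min_energetic_path G c B s P v))"
proof -
  let ?n = "card (pverts G)" and ?m = "card (parcs G)"
  let ?b = "\<lambda>st :: 'a ebf_state. queue st \<noteq> []" and ?f = "ebf_iteration adj c B"
  let ?T = "2 * ?n + 2 + ?n * (7 * ?m + 2)"
  \<comment> \<open>The time bound also proves termination: \<open>elapsed\<close> grows in every
    iteration and never exceeds \<open>?T\<close>.\<close>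
  have "run_inv (?f st) \<and> ?T - elapsed (?f st) < ?T - elapsed st" if "run_inv st" "?b st" for st
    using run_inv_step[OF that] run_inv_elapsed[OF run_inv_step(1)[OF that]] by linarith
  from measure_while_option_Some[of run_inv ?b ?f "\<lambda>st. ?T - elapsed st", OF this run_inv_init]
  obtain st where st: "while_option ?b ?f (ebf_init G s) = Some st" by blast
  have inv: "run_inv st"
    using while_option_rule[of run_inv, OF run_inv_step(1) st run_inv_init] by blast
  have q: "queue st = []" using while_option_stop[OF st] by simp
  from inv obtain k xs ys where ph: "phase k {} xs ys st" by (auto simp: run_inv_def)
  let ?st = "st\<lparr>elapsed := elapsed st + 1\<rparr>"
  have "e_BF G adj c B s = Some ?st" by (simp add: e_BF_def st)
  moreover have "elapsed ?st \<le> 14 * (max 1 ?m * ?n)"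
  proof -
    have n: "1 \<le> ?n" using s_vert pair_finite_verts card_gt_0_iff[of "pverts G"] by fastforce
    \<comment> \<open>The constant is 7 + 4 + 3: as \<open>?n \<ge> 1\<close>, each of
      \<open>?m * ?n\<close>, \<open>?n\<close> and \<open>1\<close> is at most
      \<open>max 1 ?m * ?n\<close>.\<close>
    have "1 * ?n \<le> max 1 ?m * ?n" "?m * ?n \<le> max 1 ?m * ?n" by (intro mult_le_mono1; simp)+
    moreover have "elapsed ?st \<le> 7 * (?m * ?n) + 4 * ?n + 3"
      using run_inv_elapsed[OF inv] by (simp add: algebra_simps)
    ultimately show ?thesis using n by linarith
  qed
  moreover have lab: "labels_ok ?st" "pointers_ok ?st"
    using ph by (simp_all add: phase_def labels_ok_def pointers_ok_def)
  \<comment> \<open>With an empty queue and no pending arcs, the relaxation clause of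
    \<open>phase\<close> covers every arc.\<close>
  have "dist_of ?st v \<le> oplus B (dist_of ?st u) (ereal (c (u, v)))" if "(u, v) \<in> parcs G" for u v
    using ph q that by (simp add: phase_def)
  from final_state_correct[OF lab this]
  have "\<forall>v \<in> pverts G. dist_of ?st v = energetic_cost G c B s v"
    "\<forall>v \<in> pverts G. energetic_cost G c B s v < \<infinity> \<longrightarrow>
        (\<exists>P. follow_pointers (pred_of ?st) v = Some (s, P) \<and> min_energetic_path G c B s P v)"
    by blast+
  ultimately show ?thesis by blast
qed

end

(* max 1 m instead of m: initialization alone already takes time proportional to n when m = 0. *)
theorem theorem1:
  shows "\<exists>C::nat. \<forall>(G :: 'a pair_pre_digraph) (c :: 'a \<times> 'a \<Rightarrow> real) (B :: real) (s :: 'a)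
           (adj :: 'a \<Rightarrow> 'a list).
           pair_fin_digraph G \<longrightarrow> 0 < B \<longrightarrow> s \<in> pverts G \<longrightarrow> adjacency_lists G adj \<longrightarrow>
           \<not> (\<exists>p. negative_cycle G c p \<and> traversable_cycle B c p) \<longrightarrow>
           (\<exists>st. e_BF G adj c B s = Some st \<and>
              elapsed st \<le> C * (max 1 (card (parcs G)) * card (pverts G)) \<and>
              (\<forall>v \<in> pverts G. dist_of st v = energetic_cost G c B s v) \<and>
              (\<forall>v \<in> pverts G. energetic_cost G c B s v < \<infinity> \<longrightarrow>
                 (\<exists>P. follow_pointers (pred_of st) v = Some (s, P) \<and>
                      min_energetic_path G c B s P v)))"
proof (intro exI[of _ 14] allI impI)
  fix G :: "'a pair_pre_digraph" and c B s adj
  assume "pair_fin_digraph G" "0 < B" "s \<in> pverts G" "adjacency_lists G adj"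
    "\<not> (\<exists>p. negative_cycle G c p \<and> traversable_cycle B c p)"
  then interpret ebf G c B s adj
    by (simp add: ebf_def battery_graph_def battery_graph_axioms_def ebf_axioms_def)
  show "\<exists>st. e_BF G adj c B s = Some st \<and>
      elapsed st \<le> 14 * (max 1 (card (parcs G)) * card (pverts G)) \<and>
      (\<forall>v \<in> pverts G. dist_of st v = energetic_cost G c B s v) \<and>
      (\<forall>v \<in> pverts G. energetic_cost G c B s v < \<infinity> \<longrightarrow>
         (\<exists>P. follow_pointers (pred_of st) v = Some (s, P) \<and> min_energetic_path G c B s P v))"
    by (rule e_BF_correct)
qed

end
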